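(* Let $p\ge1$ be an integer. For continuous interpolation of order $p$, if $u\in C^{p+1}(D)$ and the $(p+1)$-th derivative of $u$ is bounded on $D$, then for the linearized peridynamic force $$\sup_{i\in K}\big|\nabla PD_l^\epsilon(\mathcal{I}_h[u])(x_i)-\nabla PD_l^\epsilon(u)(x_i)\big|=O(h^p/\epsilon),$$ and for the nonlinear peridynamic force $$\sup_{i\in K}\big|\nabla PD^\epsilon(\mathcal{I}_h[u])(x_i)-\nabla PD^\epsilon(u)(x_i)\big|=O(h^p/\epsilon).$$ Here $O(h^p/\epsilon)$ means bounded by $C h^p/\epsilon$ with $C$ independent of $h$, $\epsilon$ and $i$.
   Context: $D=[a,b]\subset\mathbb{R}$ is a bounded interval, $\epsilon>0$ is the horizon, and $\partial D^\epsilon=(a-\epsilon,a+\epsilon)\cup(b-\epsilon,b+\epsilon)$ is the nonlocal boundary. $C^n(D)$ is the space of functions with $n$ continuous derivatives on $D$. In this setting, nonlocal displacements have zero boundary values on $\partial D^\epsilon$, and the local elastodynamic displacement is extended by zero outside $D$. The strain is $S(y,x;u)=\frac{u(y)-u(x)}{|y-x|}$. The function $f:[0,\infty)\to\mathbb{R}$ is positive (for $r>0$), smooth and concave with $\lim_{r\to0^+}f(r)/r=f'(0)$ and $\lim_{r\to\infty}f(r)=f_\infty<\infty$, and $f'',f''',f''''$ are bounded on $(0,\infty)$. The influence function $J(|\xi|)$ is zero for $\xi$ outside $[-1,1]$ and satisfies $0\le J(|\xi|)\le M$ on $[-1,1]$. The nonlinear and linearized peridynamic forces are $$-\nabla PD^\epsilon(u)(x)=\frac{2}{\epsilon^2}\int_{x-\epsilon}^{x+\epsilon}J(|y-x|/\epsilon)f'\big(|y-x|S(y,x;u)^2\big)S(y,x;u)\,dy,$$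 $$-\nabla PD_l^\epsilon(u)(x)=\frac{2}{\epsilon^2}\int_{x-\epsilon}^{x+\epsilon}J(|y-x|/\epsilon)f'(0)S(y,x;u)\,dy .$$ Mesh: $h>0$ is the mesh (element) size and $p$ the order of interpolation; the grid points are $x_i=ih/p$, $K=\{i\in\mathbb{Z}:ih/p\in\overline D\}$, $K^\epsilon=\{i\in\mathbb{Z}:ih/p\in\overline{\partial D^\epsilon}\}$. The elements are the intervals $[kh,(k+1)h]$, $k\in\mathbb{Z}$; $\overline D$ and $\overline{\partial D^\epsilon}$ contain an integral number of elements and $\epsilon=mh$ with $m$ a positive integer. For a function $g:\overline{D\cup\partial D^\epsilon}\to\mathbb{R}$, $\mathcal{I}_h[g]$ is the continuous local Lagrange interpolant of order $p$: on each element contained in $\overline{D\cup\partial D^\epsilon}$ it is the polynomial of degree at most $p$ agreeing with $g$ at the $p+1$ grid points of that element. *)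

theory Defs
  imports "HOL-Analysis.Analysis" "HOL-Computational_Algebra.Polynomial"
begin

text \<open>
  Iterated derivatives relative to a set \<open>S\<close>.  At boundary points of an interval these are
  one-sided, so values of the function outside \<open>S\<close> (such as an extension by zero) play no role.
\<close>

definition nderiv :: "real set \<Rightarrow> nat \<Rightarrow> (real \<Rightarrow> real) \<Rightarrow> real \<Rightarrow> real" where
  "nderiv S n f = ((\<lambda>g x. vector_derivative g (at x within S)) ^^ n) f"

definition C_on :: "nat \<Rightarrow> real set \<Rightarrow> (real \<Rightarrow> real) \<Rightarrow> bool" where
  "C_on n S f \<longleftrightarrow>
     (\<forall>k<n. nderiv S k f differentiable_on S) \<and> (\<forall>k\<le>n. continuous_on S (nderiv S k f))"

definition smooth_on :: "real set \<Rightarrow> (real \<Rightarrow> real) \<Rightarrow> bool" where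
  "smooth_on S f \<longleftrightarrow> (\<forall>n. C_on n S f)"


definition strain :: "(real \<Rightarrow> real) \<Rightarrow> real \<Rightarrow> real \<Rightarrow> real" where
  "strain u y x = (u y - u x) / \<bar>y - x\<bar>"

text \<open>
  The gradients \<open>\<nabla>PD\<close> and \<open>\<nabla>PD\<^sub>l\<close> are minus the peridynamic forces.  The derivative \<open>f'\<close>
  of \<open>f : [0,\<infinity>) \<rightarrow> \<real>\<close> is taken within \<open>[0,\<infinity>)\<close>; in particular \<open>f'(0)\<close> is one-sided.
\<close>

definition grad_PD ::
  "(real \<Rightarrow> real) \<Rightarrow> (real \<Rightarrow> real) \<Rightarrow> real \<Rightarrow> (real \<Rightarrow> real) \<Rightarrow> real \<Rightarrow> real" where
  "grad_PD f J \<epsilon> u x =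
     - (2 / \<epsilon>\<^sup>2 * (LINT y:{x-\<epsilon>..x+\<epsilon>}|lebesgue.
          J (\<bar>y - x\<bar> / \<epsilon>) * nderiv {0..} 1 f (\<bar>y - x\<bar> * (strain u y x)\<^sup>2) * strain u y x))"

definition grad_PD_lin ::
  "(real \<Rightarrow> real) \<Rightarrow> (real \<Rightarrow> real) \<Rightarrow> real \<Rightarrow> (real \<Rightarrow> real) \<Rightarrow> real \<Rightarrow> real" where
  "grad_PD_lin f J \<epsilon> u x =
     - (2 / \<epsilon>\<^sup>2 * (LINT y:{x-\<epsilon>..x+\<epsilon>}|lebesgue.
          J (\<bar>y - x\<bar> / \<epsilon>) * nderiv {0..} 1 f 0 * strain u y x))"


definition nonlocal_boundary :: "real \<Rightarrow> real \<Rightarrow> real \<Rightarrow> real set" where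
  "nonlocal_boundary a b \<epsilon> = {a-\<epsilon><..<a+\<epsilon>} \<union> {b-\<epsilon><..<b+\<epsilon>}"

definition grid_point :: "real \<Rightarrow> nat \<Rightarrow> int \<Rightarrow> real" where
  "grid_point h p i = of_int i * h / of_nat p"

definition grid_indices :: "real \<Rightarrow> nat \<Rightarrow> real set \<Rightarrow> int set" where
  "grid_indices h p X = {i. grid_point h p i \<in> closure X}"

definition mesh_element :: "real \<Rightarrow> int \<Rightarrow> real set" where
  "mesh_element h k = {of_int k * h..of_int (k + 1) * h}"

definition union_of_elements :: "real \<Rightarrow> real set \<Rightarrow> bool" where
  "union_of_elements h X \<longleftrightarrow> (\<exists>N. finite N \<and> X = (\<Union>k\<in>N. mesh_element h k))"

definition admissible_mesh :: "real \<Rightarrow> real \<Rightarrow> real \<Rightarrow> real \<Rightarrow> bool" where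
  "admissible_mesh a b \<epsilon> h \<longleftrightarrow>
     0 < h \<and> (\<exists>m::nat. 0 < m \<and> \<epsilon> = of_nat m * h) \<and>
     union_of_elements h (closure {a..b}) \<and>
     union_of_elements h (closure (nonlocal_boundary a b \<epsilon>))"


text \<open>
  The grid points of element \<open>k\<close> are those with indices \<open>k p, \<dots>, k p + p\<close>.  For \<open>h > 0\<close> and \<open>p \<ge> 1\<close>
  the interpolating polynomial exists uniquely (lemma \<open>local_interp_unique\<close> below).
\<close>

definition is_local_interp :: "real \<Rightarrow> nat \<Rightarrow> (real \<Rightarrow> real) \<Rightarrow> int \<Rightarrow> real poly \<Rightarrow> bool" where
  "is_local_interp h p g k q \<longleftrightarrow> degree q \<le> p \<and>
     (\<forall>j\<le>p. poly q (grid_point h p (k * int p + int j)) = g (grid_point h p (k * int p + int j)))"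

text \<open>
  The definition selects, at a common endpoint of two elements, the element to its right; the
  polynomials of both elements agree there, which is lemma \<open>interpolant_on_element\<close>.  The interpolant
  is defined on all of \<open>\<real>\<close>, but on an element it depends only on the values of \<open>g\<close> at the grid points
  of that element.
\<close>

definition interpolant :: "real \<Rightarrow> nat \<Rightarrow> (real \<Rightarrow> real) \<Rightarrow> real \<Rightarrow> real" where
  "interpolant h p g x = poly (THE q. is_local_interp h p g \<lfloor>x / h\<rfloor> q) x"

lemma grid_point_eq_iff:
  assumes "h > 0" "p \<ge> 1"
  shows "grid_point h p i = grid_point h p j \<longleftrightarrow> i = j"
  using assms by (simp add: grid_point_def field_simps)

lemma interp_poly_exists:
  fixes g :: "real \<Rightarrow> real"
  assumes "finite A"
  shows "\<exists>q. degree q \<le> card A - 1 \<and> (\<forall>x\<in>A. poly q x = g x)"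
  using assms
proof (induction A rule: finite_induct)
  case empty
  then show ?case by (auto intro: exI[of _ 0])
next
  case (insert z A)
  then obtain q where q: "degree q \<le> card A - 1" "\<forall>x\<in>A. poly q x = g x" by blast
  define w where "w = (\<Prod>x\<in>A. [:- x, 1:])"
  have w0: "poly w x = 0" if "x \<in> A" for x
    using that insert.hyps by (auto simp: w_def poly_prod)
  have wz: "poly w z \<noteq> 0"
    using insert.hyps by (auto simp: w_def poly_prod)
  have "degree w \<le> (\<Sum>x\<in>A. degree [:- x, 1:])"
    unfolding w_def by (rule degree_prod_sum_le[OF insert.hyps(1), unfolded o_def])
  then have dw: "degree w \<le> card A" by simp
  define r where "r = q + smult ((g z - poly q z) / poly w z) w"
  have "degree r \<le> card A"
    unfolding r_def using q(1) dw by (intro degree_add_le) (auto intro: order.trans[OF degree_smult_le])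
  moreover have "\<forall>x\<in>insert z A. poly r x = g x"
    using q(2) w0 wz by (auto simp: r_def)
  ultimately show ?case using insert.hyps by auto
qed

lemma local_interp_unique:
  assumes "h > 0" "p \<ge> 1"
  shows "\<exists>!q. is_local_interp h p g k q"
proof -
  define A where "A = (\<lambda>j. grid_point h p (k * int p + int j)) ` {..p}"
  have "inj_on (\<lambda>j. grid_point h p (k * int p + int j)) {..p}"
    by (rule inj_onI) (simp add: grid_point_eq_iff[OF assms])
  then have A: "finite A" "card A = Suc p" by (auto simp: A_def card_image)
  have iff: "is_local_interp h p g k q \<longleftrightarrow> degree q \<le> p \<and> (\<forall>x\<in>A. poly q x = g x)" for q
    by (auto simp: is_local_interp_def A_def)
  obtain q where "is_local_interp h p g k q"
    using interp_poly_exists[OF A(1), of g] A(2) by (auto simp: iff)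
  moreover have "q = r" if "is_local_interp h p g k q" "is_local_interp h p g k r" for q r
    using that A by (intro poly_eqI_degree[of A]) (auto simp: iff)
  ultimately show ?thesis by blast
qed

lemma interpolant_on_element:
  assumes "h > 0" "p \<ge> 1" "is_local_interp h p g k q" "x \<in> mesh_element h k"
  shows "interpolant h p g x = poly q x"
proof -
  have the: "is_local_interp h p g k' (THE q. is_local_interp h p g k' q)" for k'
    by (rule theI'[OF local_interp_unique[OF assms(1,2)]])
  show ?thesis
  proof (cases "x = of_int (k + 1) * h")
    case True
    then have fl: "\<lfloor>x / h\<rfloor> = k + 1" using assms(1) by simp
    have x1: "x = grid_point h p (k * int p + int p)"
      using True assms(2) by (simp add: grid_point_def field_simps)
    have x2: "x = grid_point h p ((k + 1) * int p + int 0)"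
      using True assms(2) by (simp add: grid_point_def field_simps)
    have "poly q x = g x"
      using assms(3) unfolding is_local_interp_def x1 by blast
    moreover have "interpolant h p g x = g x"
    proof -
      have "poly r (grid_point h p ((k + 1) * int p + int 0)) =
          g (grid_point h p ((k + 1) * int p + int 0))" if "is_local_interp h p g (k + 1) r" for r
        using that unfolding is_local_interp_def by blast
      from this[OF the, folded x2] show ?thesis unfolding interpolant_def fl .
    qed
    ultimately show ?thesis by simp
  next
    case False
    then have "\<lfloor>x / h\<rfloor> = k"
      using assms(1,4) by (simp add: floor_eq_iff mesh_element_def field_simps)
    moreover have "(THE q. is_local_interp h p g k q) = q"
      by (rule the1_equality[OF local_interp_unique[OF assms(1,2)] assms(3)])
    ultimately show ?thesis by (simp add: interpolant_def)
  qed
qed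

end

theory Submission
  imports Defs
begin

text \<open>
  Let \<open>w = I\<^sub>h u - u\<close> be the interpolation error.  On each element of \<open>[a, b]\<close> it vanishes at
  \<open>p + 1\<close> points, so by repeated use of Rolle's theorem each of its derivatives up to order \<open>p\<close> has
  a zero there; integrating down from the bounded derivative of order \<open>p + 1\<close> gives
  \<open>\<bar>w'\<bar> \<le> B h\<^sup>p\<close>.  Since \<open>w\<close> vanishes at every grid point and outside \<open>[a, b]\<close>, this yields
  \<open>\<bar>w y\<bar> \<le> B h\<^sup>p \<bar>y - x\<bar>\<close> for every grid point \<open>x\<close> and every \<open>y\<close>
  (\<open>interpolation_error_from_grid_point\<close>).  In other words, interpolation changes every strain
  seen from a grid point by at most \<open>B h\<^sup>p\<close>.

  Both forces integrate \<open>J \<phi>(r s\<^sup>2) s\<close>, where \<open>s\<close> is the strain and \<open>r = \<bar>y - x\<bar>\<close>, with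
  \<open>\<phi> = f'\<close> or \<open>\<phi> = f'(0)\<close>.  This integrand is Lipschitz in \<open>s\<close> uniformly in \<open>r\<close>
  (\<open>bond_force_bounds\<close>): \<open>r s\<close> is a difference of displacements, so \<open>r s\<^sup>2\<close> stays bounded however
  large the horizon is, and \<open>\<phi>\<close> is Lipschitz because \<open>f''\<close> is bounded.  The integrands therefore
  differ by \<open>O(h\<^sup>p)\<close>; integrating over a length \<open>2 \<epsilon>\<close> with the prefactor \<open>2 / \<epsilon>\<^sup>2\<close> leaves
  \<open>O(h\<^sup>p / \<epsilon>)\<close> (\<open>pd_gradient_diff_bound\<close>).
\<close>

section \<open>Iterated derivatives and Rolle's theorem\<close>

lemma nderiv_has_derivative:
  assumes "C_on n S f" "k < n" "x \<in> S"
  shows "(nderiv S k f has_real_derivative nderiv S (Suc k) f x) (at x within S)"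
proof -
  have "nderiv S k f differentiable at x within S"
    using assms by (auto simp: C_on_def differentiable_on_def)
  then show ?thesis
    by (simp add: vector_derivative_works has_real_derivative_iff_has_vector_derivative nderiv_def)
qed

lemma lipschitz_of_derivative_bound:
  fixes g g' :: "real \<Rightarrow> real"
  assumes "\<And>x. x \<in> {c..d} \<Longrightarrow> (g has_real_derivative g' x) (at x within {c..d})"
    and "\<And>x. x \<in> {c..d} \<Longrightarrow> \<bar>g' x\<bar> \<le> B"
    and "x \<in> {c..d}" "y \<in> {c..d}"
  shows "\<bar>g x - g y\<bar> \<le> B * \<bar>x - y\<bar>"
  using field_differentiable_bound[of "{c..d}" g g' B x y] assms by auto

text \<open>
  Between consecutive zeros Rolle's theorem yields a zero of the derivative; the new zeros are again
  strictly increasing, which is what lets the argument be repeated.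
\<close>

lemma higher_derivative_has_zero:
  fixes G :: "nat \<Rightarrow> real \<Rightarrow> real"
  assumes "\<And>k x. k < n \<Longrightarrow> x \<in> {c..d} \<Longrightarrow> (G k has_real_derivative G (Suc k) x) (at x within {c..d})"
    and "\<And>j. j < n \<Longrightarrow> z j < z (Suc j)"
    and "\<And>j. j \<le> n \<Longrightarrow> z j \<in> {c..d} \<and> G 0 (z j) = 0"
    and "k \<le> n"
  shows "\<exists>x\<in>{c..d}. G k x = 0"
  using assms
proof (induction n arbitrary: G z k)
  case 0
  then show ?case by blast
next
  case (Suc n)
  show ?case
  proof (cases k)
    case 0
    then show ?thesis using Suc.prems(3) by blast
  next
    case (Suc k')
    have "\<exists>t. z j < t \<and> t < z (Suc j) \<and> G 1 t = 0" if "j \<le> n" for j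
    proof -
      have lt: "z j < z (Suc j)" and sub: "{z j..z (Suc j)} \<subseteq> {c..d}"
        using Suc.prems(2)[of j] Suc.prems(3)[of j] Suc.prems(3)[of "Suc j"] that by auto
      have der: "(G 0 has_derivative (\<lambda>s. G 1 x * s)) (at x within {z j..z (Suc j)})"
        if "z j \<le> x" "x \<le> z (Suc j)" for x
        using DERIV_subset[OF Suc.prems(1)[of 0 x] sub] that sub
        by (auto simp: has_field_derivative_def)
      from mvt_simple[OF lt der] obtain t where "t \<in> {z j<..<z (Suc j)}"
        "G 0 (z (Suc j)) - G 0 (z j) = G 1 t * (z (Suc j) - z j)" by blast
      then show ?thesis
        using lt Suc.prems(3)[of j] Suc.prems(3)[of "Suc j"] that by auto
    qed
    then obtain t where t: "\<And>j. j \<le> n \<Longrightarrow> z j < t j \<and> t j < z (Suc j) \<and> G 1 (t j) = 0"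
      by metis
    have "\<exists>x\<in>{c..d}. G (Suc k') x = 0"
    proof (rule Suc.IH[of "\<lambda>i. G (Suc i)" t k'])
      show "t j < t (Suc j)" if "j < n" for j
        using t[of j] t[of "Suc j"] that by force
      show "t j \<in> {c..d} \<and> G (Suc 0) (t j) = 0" if "j \<le> n" for j
        using t[of j] Suc.prems(3)[of j] Suc.prems(3)[of "Suc j"] that by auto
    qed (use Suc.prems(1,4) Suc in auto)
    then show ?thesis using Suc by simp
  qed
qed

text \<open>
  Each derivative has a zero in the interval, so it is at most the interval length times the bound of
  the next one.  The induction therefore runs from the top derivative downwards.
\<close>

lemma derivative_bound_from_zeros:
  fixes G :: "nat \<Rightarrow> real \<Rightarrow> real"
  assumes der: "\<And>k x. k \<le> n \<Longrightarrow> x \<in> {c..d} \<Longrightarrow>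
      (G k has_real_derivative G (Suc k) x) (at x within {c..d})"
    and zero: "\<And>k. k \<le> n \<Longrightarrow> \<exists>x\<in>{c..d}. G k x = 0"
    and bound: "\<And>x. x \<in> {c..d} \<Longrightarrow> \<bar>G (Suc n) x\<bar> \<le> B"
    and "j \<le> Suc n" "x \<in> {c..d}"
  shows "\<bar>G (Suc n - j) x\<bar> \<le> B * (d - c) ^ j"
  using assms(4,5)
proof (induction j arbitrary: x)
  case 0
  then show ?case using bound by simp
next
  case (Suc j)
  define k where "k = n - j"
  have k: "k \<le> n" "Suc n - Suc j = k" "Suc n - j = Suc k"
    using Suc.prems(1) by (auto simp: k_def)
  obtain z where z: "z \<in> {c..d}" "G k z = 0" using zero k(1) by blast
  have IH: "\<bar>G (Suc k) y\<bar> \<le> B * (d - c) ^ j" if "y \<in> {c..d}" for y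
    using Suc.IH[OF _ that] Suc.prems(1) k(3) by simp
  have "\<bar>G k x - G k z\<bar> \<le> B * (d - c) ^ j * \<bar>x - z\<bar>"
    using lipschitz_of_derivative_bound[OF der[OF k(1)] IH Suc.prems(2) z(1)] by blast
  also have "\<dots> \<le> B * (d - c) ^ j * (d - c)"
  proof (rule mult_left_mono)
    show "\<bar>x - z\<bar> \<le> d - c" using Suc.prems(2) z(1) by auto
    show "0 \<le> B * (d - c) ^ j" using IH[OF z(1)] abs_ge_zero order.trans by blast
  qed
  finally show ?case using z(2) k(2) by (simp add: ac_simps)
qed

section \<open>The interpolation error\<close>

lemma higher_pderiv_eq_0:
  fixes q :: "real poly"
  assumes "degree q \<le> p"
  shows "(pderiv ^^ Suc p) q = 0"
proof -
  have "degree ((pderiv ^^ k) q) = degree q - k" for k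
    by (induction k) (auto simp: degree_pderiv)
  then show ?thesis using assms by (simp add: pderiv_eq_0_iff)
qed

lemma grid_point_in_element:
  assumes "h > 0" "p \<ge> 1" "j \<le> p"
  shows "grid_point h p (k * int p + int j) \<in> mesh_element h k"
proof -
  have "grid_point h p (k * int p + int j) = of_int k * h + of_nat j * h / of_nat p"
    using assms by (simp add: grid_point_def field_simps)
  moreover have "0 \<le> of_nat j * h / of_nat p" "of_nat j * h / of_nat p \<le> h"
    using assms by (simp_all add: field_simps)
  moreover have "real_of_int (k + 1) * h = of_int k * h + h" by (simp add: algebra_simps)
  ultimately show ?thesis by (simp only: mesh_element_def atLeastAtMost_iff) linarith
qed

lemma interpolant_grid_point:
  assumes "h > 0" "p \<ge> 1"
  shows "interpolant h p g (grid_point h p i) = g (grid_point h p i)"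
proof -
  define k j where "k = i div int p" and "j = nat (i mod int p)"
  have i: "i = k * int p + int j" and j: "j \<le> p"
    using assms(2) pos_mod_bound[of "int p" i] pos_mod_sign[of "int p" i]
    by (auto simp: k_def j_def nat_le_iff simp del: pos_mod_bound pos_mod_sign)
  obtain q where q: "is_local_interp h p g k q"
    using local_interp_unique[OF assms] by blast
  have "interpolant h p g (grid_point h p i) = poly q (grid_point h p i)"
    using interpolant_on_element[OF assms q] grid_point_in_element[OF assms j] i by simp
  also have "\<dots> = g (grid_point h p i)"
    using q j i by (simp add: is_local_interp_def)
  finally show ?thesis .
qed

text \<open>
  The error \<open>q - g\<close> on an element vanishes at the \<open>p + 1\<close> grid points, and its derivative of order
  \<open>p + 1\<close> is that of \<open>- g\<close> because \<open>q\<close> has degree at most \<open>p\<close>.  Passing from order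
  \<open>p + 1\<close> to order \<open>1\<close> gains a factor \<open>h\<close> at each of \<open>p\<close> steps.
\<close>

lemma interpolation_error_lipschitz_on_element:
  assumes hp: "h > 0" "p \<ge> 1"
    and g: "C_on (p + 1) S g" "mesh_element h k \<subseteq> S"
    and B: "\<And>x. x \<in> S \<Longrightarrow> \<bar>nderiv S (p + 1) g x\<bar> \<le> B"
    and xy: "x \<in> mesh_element h k" "y \<in> mesh_element h k"
  shows "\<bar>(interpolant h p g x - g x) - (interpolant h p g y - g y)\<bar> \<le> B * h ^ p * \<bar>x - y\<bar>"
proof -
  define c d where "c = of_int k * h" and "d = of_int (k + 1) * h"
  have E: "mesh_element h k = {c..d}" and dc: "d - c = h"
    by (simp_all add: c_def d_def mesh_element_def algebra_simps)
  obtain q where q: "is_local_interp h p g k q"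
    using local_interp_unique[OF hp] by blast
  define G where "G = (\<lambda>i x. poly ((pderiv ^^ i) q) x - nderiv S i g x)"
  have G0: "G 0 x = interpolant h p g x - g x" if "x \<in> {c..d}" for x
    using interpolant_on_element[OF hp q] that E by (simp add: G_def nderiv_def)
  have der: "(G i has_real_derivative G (Suc i) x) (at x within {c..d})"
    if "i \<le> p" "x \<in> {c..d}" for i x
  proof -
    have "(nderiv S i g has_real_derivative nderiv S (Suc i) g x) (at x within {c..d})"
      by (rule DERIV_subset[OF nderiv_has_derivative[OF g(1)]]) (use g(2) that E in auto)
    moreover have "(poly ((pderiv ^^ i) q) has_real_derivative poly ((pderiv ^^ Suc i) q) x)
        (at x within {c..d})"
      by (simp add: poly_DERIV DERIV_subset[of _ _ _ UNIV])
    ultimately show ?thesis unfolding G_def by (intro DERIV_diff)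
  qed
  have top: "\<bar>G (Suc p) x\<bar> \<le> B" if "x \<in> {c..d}" for x
    using B[of x] that g(2) E higher_pderiv_eq_0[of q p] q
    by (auto simp: G_def is_local_interp_def simp del: funpow.simps)
  have zeros: "\<exists>x\<in>{c..d}. G i x = 0" if "i \<le> p" for i
  proof (rule higher_derivative_has_zero[where z = "\<lambda>j. grid_point h p (k * int p + int j)"])
    show "grid_point h p (k * int p + int j) < grid_point h p (k * int p + int (Suc j))" for j
      using hp by (simp add: grid_point_def field_simps)
    show "grid_point h p (k * int p + int j) \<in> {c..d} \<and> G 0 (grid_point h p (k * int p + int j)) = 0"
      if "j \<le> p" for j
      using grid_point_in_element[OF hp that, of k] G0 E
      by (simp add: interpolant_grid_point[OF hp])
  qed (use der that in auto)
  have first: "\<bar>G 1 x\<bar> \<le> B * h ^ p" if "x \<in> {c..d}" for x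
    using derivative_bound_from_zeros[where G = G and j = p, OF der zeros top _ that] dc by simp
  have "\<bar>G 0 x - G 0 y\<bar> \<le> B * h ^ p * \<bar>x - y\<bar>"
    by (rule lipschitz_of_derivative_bound[where g' = "G 1" and c = c and d = d])
       (use der[of 0] first xy E in auto)
  then show ?thesis using G0 xy E by simp
qed

text \<open>The interpolant is selected among countably many polynomials by the integer \<open>\<lfloor>x / h\<rfloor>\<close>.\<close>

lemma interpolant_measurable: "interpolant h p g \<in> borel_measurable borel"
proof -
  have "(\<lambda>x. (\<lambda>k x. poly (THE q. is_local_interp h p g k q) x) \<lfloor>x / h\<rfloor> x) \<in> borel_measurable borel"
    by (rule measurable_compose_countable)
       (auto intro!: borel_measurable_continuous_onI continuous_intros)
  then show ?thesis by (simp add: interpolant_def[abs_def])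
qed

text \<open>
  The end \<open>a\<close> lies in an element contained in \<open>[a, b]\<close>, so it can only be the left end of that
  element, and likewise for \<open>b\<close>.
\<close>

lemma interval_union_of_elements:
  assumes h: "h > 0" and ab: "a < b" and U: "union_of_elements h {a..b}"
  obtains k l where "a = of_int k * h" "b = of_int l * h" "k < l"
proof -
  obtain N where N: "{a..b} = (\<Union>k\<in>N. mesh_element h k)"
    using U by (auto simp: union_of_elements_def)
  have ends: "of_int k * h \<in> {a..b}" "of_int (k + 1) * h \<in> {a..b}" if "k \<in> N" for k
  proof -
    have "of_int k * h \<in> mesh_element h k" "of_int (k + 1) * h \<in> mesh_element h k"
      using h by (auto simp: mesh_element_def algebra_simps)
    then show "of_int k * h \<in> {a..b}" "of_int (k + 1) * h \<in> {a..b}"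
      using that N by blast+
  qed
  have "a \<in> {a..b}" "b \<in> {a..b}" using ab by auto
  then obtain k l where k: "k \<in> N" "a \<in> mesh_element h k" and l: "l \<in> N" "b \<in> mesh_element h l"
    using N by blast
  have "a = of_int k * h" "b = of_int (l + 1) * h"
    using ends(1)[OF k(1)] ends(2)[OF l(1)] k(2) l(2) by (auto simp: mesh_element_def)
  moreover have "k < l + 1"
    using ab h calculation by (simp add: mult_less_cancel_right_pos)
  ultimately show ?thesis using that by blast
qed

text \<open>
  A grid point \<open>x\<close> is a zero of the error.  For \<open>y\<close> in an element that does not contain \<open>x\<close>,
  the endpoint of that element facing \<open>x\<close> is a zero closer to \<open>y\<close>, so the Lipschitz bound on
  single elements suffices.  Outside \<open>[a, b]\<close> both functions vanish.
\<close>

lemma interpolation_error_from_grid_point: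
  assumes hp: "h > 0" "p \<ge> 1"
    and ab: "a = of_int k0 * h" "b = of_int l0 * h"
    and g: "C_on (p + 1) {a..b} g"
    and B: "\<And>x. x \<in> {a..b} \<Longrightarrow> \<bar>nderiv {a..b} (p + 1) g x\<bar> \<le> B" "0 \<le> B"
    and g0: "\<And>x. x \<notin> {a<..<b} \<Longrightarrow> g x = 0"
  shows "\<bar>interpolant h p g y - g y\<bar> \<le> B * h ^ p * \<bar>y - grid_point h p i\<bar>"
    and "y \<notin> {a..b} \<Longrightarrow> interpolant h p g y = 0"
proof -
  define x where "x = grid_point h p i"
  define k where "k = \<lfloor>y / h\<rfloor>"
  have ky: "of_int k * h \<le> y" "y < of_int (k + 1) * h"
    using hp floor_divide_lower[of h y] floor_divide_upper[of h y] by (auto simp: k_def)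
  then have y: "y \<in> mesh_element h k" by (simp add: mesh_element_def)
  define c d where "c = of_int k * h" and "d = of_int (k + 1) * h"
  have E: "mesh_element h k = {c..d}" and cd: "c \<le> d"
    using hp by (simp_all add: c_def d_def mesh_element_def)
  define w where "w = (\<lambda>y. interpolant h p g y - g y)"
  have "w (grid_point h p (k * int p)) = 0" "w (grid_point h p ((k + 1) * int p)) = 0" "w x = 0"
    by (simp_all add: w_def x_def interpolant_grid_point[OF hp])
  moreover have "grid_point h p (k * int p) = c" "grid_point h p ((k + 1) * int p) = d"
    using hp by (simp_all add: grid_point_def c_def d_def)
  ultimately have w0: "w c = 0" "w d = 0" "w x = 0" by simp_all
  have Bh: "0 \<le> B * h ^ p" using B hp by simp
  have outside: "interpolant h p g y = 0" if "k + 1 \<le> k0 \<or> l0 \<le> k"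
  proof -
    have off: "z \<notin> {a<..<b}" if z: "z \<in> mesh_element h k" for z
    proof -
      have "real_of_int (k + 1) * h \<le> a \<or> b \<le> real_of_int k * h"
        using \<open>k + 1 \<le> k0 \<or> l0 \<le> k\<close> hp unfolding ab
        by (metis mult_right_mono of_int_le_iff less_imp_le)
      then show ?thesis using z by (auto simp: mesh_element_def)
    qed
    have "is_local_interp h p g k 0"
      using g0[OF off[OF grid_point_in_element[OF hp]]] by (simp add: is_local_interp_def)
    from interpolant_on_element[OF hp this y] show ?thesis by simp
  qed
  have "\<bar>w y\<bar> \<le> B * h ^ p * \<bar>y - x\<bar>"
  proof (cases "k + 1 \<le> k0 \<or> l0 \<le> k")
    case True
    then have "real_of_int (k + 1) * h \<le> a \<or> b \<le> real_of_int k * h"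
      using hp unfolding ab by (metis mult_right_mono of_int_le_iff less_imp_le)
    then have "g y = 0" using g0[of y] ky by auto
    then show ?thesis using outside[OF True] Bh by (simp add: w_def)
  next
    case False
    then have "a \<le> c" "d \<le> b"
      using hp unfolding ab c_def d_def
      by (auto intro!: mult_right_mono simp del: of_int_add simp: of_int_le_iff)
    then have sub: "mesh_element h k \<subseteq> {a..b}" using E by auto
    have lip: "\<bar>w y - w z\<bar> \<le> B * h ^ p * \<bar>y - z\<bar>" if "z \<in> {c..d}" for z
      using interpolation_error_lipschitz_on_element[OF hp g sub B(1) y] that E by (simp add: w_def)
    have "\<exists>z\<in>{c..d}. w z = 0 \<and> \<bar>y - z\<bar> \<le> \<bar>y - x\<bar>"
    proof -
      consider "x < c" | "x \<in> {c..d}" | "d < x" by fastforce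
      then show ?thesis
      proof cases
        case 1
        then show ?thesis using w0 cd y E by (intro bexI[of _ c]) auto
      next
        case 2
        then show ?thesis using w0 by blast
      next
        case 3
        then show ?thesis using w0 cd y E by (intro bexI[of _ d]) auto
      qed
    qed
    then obtain z where "z \<in> {c..d}" "w z = 0" "\<bar>y - z\<bar> \<le> \<bar>y - x\<bar>" by blast
    then show ?thesis
      using lip[of z] mult_left_mono[OF _ Bh, of "\<bar>y - z\<bar>" "\<bar>y - x\<bar>"] by simp
  qed
  then show "\<bar>interpolant h p g y - g y\<bar> \<le> B * h ^ p * \<bar>y - grid_point h p i\<bar>"
    by (simp add: w_def x_def)
  show "interpolant h p g y = 0" if "y \<notin> {a..b}"
  proof (rule outside, rule ccontr)
    assume "\<not> (k + 1 \<le> k0 \<or> l0 \<le> k)"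
    then have "a \<le> c" "d \<le> b"
      using hp unfolding ab c_def d_def
      by (auto intro!: mult_right_mono simp del: of_int_add simp: of_int_le_iff)
    then show False using that y E by auto
  qed
qed

section \<open>Peridynamic forces with a general constitutive function\<close>

text \<open>
  The nonlinear force is the case \<open>\<phi> = f'\<close>, the linearized force the case of the constant
  \<open>\<phi> = f'(0)\<close>, so that one estimate in terms of a Lipschitz bound for \<open>\<phi>\<close> covers both.
\<close>

definition pd_gradient ::
  "(real \<Rightarrow> real) \<Rightarrow> (real \<Rightarrow> real) \<Rightarrow> real \<Rightarrow> (real \<Rightarrow> real) \<Rightarrow> real \<Rightarrow> real" where
  "pd_gradient \<phi> J \<epsilon> u x =
     - (2 / \<epsilon>\<^sup>2 * (LINT y:{x-\<epsilon>..x+\<epsilon>}|lebesgue.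
          J (\<bar>y - x\<bar> / \<epsilon>) * (\<phi> (\<bar>y - x\<bar> * (strain u y x)\<^sup>2) * strain u y x)))"

lemma grad_PD_eq: "grad_PD f = pd_gradient (nderiv {0..} 1 f)"
  by (simp add: fun_eq_iff grad_PD_def pd_gradient_def mult.assoc)

lemma grad_PD_lin_eq: "grad_PD_lin f = pd_gradient (\<lambda>_. nderiv {0..} 1 f 0)"
  by (simp add: fun_eq_iff grad_PD_lin_def pd_gradient_def mult.assoc)

text \<open>
  For a displacement difference \<open>d\<close> across a bond of length \<open>r\<close> and the strain \<open>s = d / r\<close>, the
  argument of \<open>\<phi>\<close> is \<open>r s\<^sup>2 = d s\<close>, at most \<open>A \<Lambda>\<close>.  Two bounds on \<open>d\<close> are used because
  \<open>\<Lambda> r\<close> alone would make the constant grow with the horizon.  For two strains,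
  \<open>r s\<^sub>1\<^sup>2 - r s\<^sub>2\<^sup>2 = (d\<^sub>1 + d\<^sub>2) (s\<^sub>1 - s\<^sub>2)\<close>, so changing the argument of \<open>\<phi>\<close> costs
  \<open>2 \<kappa> A \<Lambda> L\<close> and changing the factor \<open>s\<close> costs \<open>(\<beta> + \<kappa> A \<Lambda>) L\<close>.
\<close>

lemma bond_force_bounds:
  fixes \<phi> :: "real \<Rightarrow> real"
  assumes \<phi>0: "\<bar>\<phi> 0\<bar> \<le> \<beta>"
    and lip: "\<And>s t. 0 \<le> s \<Longrightarrow> 0 \<le> t \<Longrightarrow> \<bar>\<phi> s - \<phi> t\<bar> \<le> \<kappa> * \<bar>s - t\<bar>"
    and \<kappa>: "0 \<le> \<kappa>" and r: "0 < r"
    and d1: "\<bar>d1\<bar> \<le> \<Lambda> * r" "\<bar>d1\<bar> \<le> A"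
  shows "\<bar>\<phi> (r * (d1 / r)\<^sup>2) * (d1 / r)\<bar> \<le> (\<beta> + \<kappa> * A * \<Lambda>) * \<Lambda>" (is ?bound)
    and "\<bar>d2\<bar> \<le> \<Lambda> * r \<Longrightarrow> \<bar>d2\<bar> \<le> A \<Longrightarrow> \<bar>d1 - d2\<bar> \<le> L * r \<Longrightarrow>
      \<bar>\<phi> (r * (d1 / r)\<^sup>2) * (d1 / r) - \<phi> (r * (d2 / r)\<^sup>2) * (d2 / r)\<bar>
        \<le> (\<beta> + 3 * \<kappa> * A * \<Lambda>) * L"
proof -
  define s1 where "s1 = d1 / r"
  have s1: "\<bar>s1\<bar> \<le> \<Lambda>" and e1: "r * s1\<^sup>2 = d1 * s1"
    using r d1 by (auto simp: s1_def field_simps power2_eq_square)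
  have pos: "0 \<le> A" "0 \<le> \<Lambda>" "0 \<le> \<beta>" using d1 s1 \<phi>0 by linarith+
  have "\<bar>d1 * s1\<bar> \<le> A * \<Lambda>"
    unfolding abs_mult by (rule mult_mono) (use d1 s1 pos in auto)
  moreover have "0 \<le> r * s1\<^sup>2" using r by simp
  ultimately have "\<bar>\<phi> (r * s1\<^sup>2) - \<phi> 0\<bar> \<le> \<kappa> * (A * \<Lambda>)"
    using lip[of "r * s1\<^sup>2" 0] mult_left_mono[OF _ \<kappa>, of "\<bar>r * s1\<^sup>2\<bar>" "A * \<Lambda>"] e1 by fastforce
  then have \<phi>1: "\<bar>\<phi> (r * s1\<^sup>2)\<bar> \<le> \<beta> + \<kappa> * A * \<Lambda>" using \<phi>0 by linarith
  show ?bound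
    unfolding abs_mult s1_def[symmetric]
    by (rule mult_mono) (use \<phi>1 s1 pos \<kappa> in auto)
  assume d2: "\<bar>d2\<bar> \<le> \<Lambda> * r" "\<bar>d2\<bar> \<le> A" and d12: "\<bar>d1 - d2\<bar> \<le> L * r"
  define s2 where "s2 = d2 / r"
  have s2: "\<bar>s2\<bar> \<le> \<Lambda>" and e2: "r * s2\<^sup>2 = d2 * s2"
    using r d2 by (auto simp: s2_def field_simps power2_eq_square)
  have "s1 - s2 = (d1 - d2) / r" by (simp add: s1_def s2_def diff_divide_distrib)
  then have s12: "\<bar>s1 - s2\<bar> \<le> L" using d12 r by (simp add: abs_divide pos_divide_le_eq)
  have "r * s1\<^sup>2 - r * s2\<^sup>2 = (d1 + d2) * (s1 - s2)"
    using r by (simp add: s1_def s2_def field_simps power2_eq_square)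
  moreover have "\<bar>(d1 + d2) * (s1 - s2)\<bar> \<le> (2 * A) * L"
    unfolding abs_mult by (rule mult_mono) (use d1 d2 s12 in auto)
  ultimately have "\<bar>\<phi> (r * s1\<^sup>2) - \<phi> (r * s2\<^sup>2)\<bar> \<le> \<kappa> * (2 * A * L)"
    using lip[of "r * s1\<^sup>2" "r * s2\<^sup>2"] r mult_left_mono[OF _ \<kappa>, of "\<bar>r * s1\<^sup>2 - r * s2\<^sup>2\<bar>" "2 * A * L"]
    by fastforce
  then have "\<bar>(\<phi> (r * s1\<^sup>2) - \<phi> (r * s2\<^sup>2)) * s2\<bar> \<le> \<kappa> * (2 * A * L) * \<Lambda>"
    unfolding abs_mult by (rule mult_mono) (use s2 s12 pos \<kappa> in auto)
  moreover have "\<bar>\<phi> (r * s1\<^sup>2) * (s1 - s2)\<bar> \<le> (\<beta> + \<kappa> * A * \<Lambda>) * L"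
    unfolding abs_mult by (rule mult_mono) (use \<phi>1 s12 pos \<kappa> in auto)
  moreover have "\<phi> (r * s1\<^sup>2) * s1 - \<phi> (r * s2\<^sup>2) * s2 =
      \<phi> (r * s1\<^sup>2) * (s1 - s2) + (\<phi> (r * s1\<^sup>2) - \<phi> (r * s2\<^sup>2)) * s2"
    by (simp add: algebra_simps)
  moreover have "(\<beta> + 3 * \<kappa> * A * \<Lambda>) * L = (\<beta> + \<kappa> * A * \<Lambda>) * L + \<kappa> * (2 * A * L) * \<Lambda>"
    by (simp add: algebra_simps)
  ultimately show "\<bar>\<phi> (r * (d1 / r)\<^sup>2) * (d1 / r) - \<phi> (r * (d2 / r)\<^sup>2) * (d2 / r)\<bar>
        \<le> (\<beta> + 3 * \<kappa> * A * \<Lambda>) * L"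
    unfolding s1_def[symmetric] s2_def[symmetric] by linarith
qed

text \<open>
  Boundedness of both integrands on the bounded interval makes them integrable; otherwise the
  Lebesgue integral could take its default value 0 and the difference would not be controlled.
\<close>

lemma set_integral_diff_bound:
  fixes G1 G2 :: "real \<Rightarrow> real"
  assumes meas: "G1 \<in> borel_measurable lebesgue" "G2 \<in> borel_measurable lebesgue"
    and bounds: "\<And>y. \<bar>G1 y\<bar> \<le> K" "\<And>y. \<bar>G2 y\<bar> \<le> K" "\<And>y. \<bar>G1 y - G2 y\<bar> \<le> L"
    and cd: "c \<le> d"
  shows "\<bar>(LINT y:{c..d}|lebesgue. G1 y) - (LINT y:{c..d}|lebesgue. G2 y)\<bar> \<le> L * (d - c)"
proof -
  have int: "set_integrable lebesgue {c..d} G"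
    if "G \<in> borel_measurable lebesgue" "\<And>y. \<bar>G y\<bar> \<le> C" for G :: "real \<Rightarrow> real" and C
    unfolding set_integrable_def
    by (rule integrableI_bounded_set[where A = "{c..d}" and B = C])
       (use that cd in \<open>auto intro!: AE_I2 borel_measurable_times borel_measurable_indicator\<close>)
  have i: "set_integrable lebesgue {c..d} G1" "set_integrable lebesgue {c..d} G2"
    using int meas bounds by blast+
  have "\<bar>LINT y:{c..d}|lebesgue. (G1 y - G2 y)\<bar> \<le> (LINT y:{c..d}|lebesgue. \<bar>G1 y - G2 y\<bar>)"
    using set_integral_norm_bound[OF set_integral_diff(1)[OF i]] by simp
  also have "\<dots> \<le> (LINT y:{c..d}|lebesgue. L)"
    by (rule set_integral_mono) (use set_integral_diff(1)[OF i] bounds int[of "\<lambda>_. L" "\<bar>L\<bar>"] in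
        \<open>auto intro: set_integrable_abs\<close>)
  also have "\<dots> = L * (d - c)"
    using cd by (simp add: set_lebesgue_integral_def)
  finally show ?thesis using set_integral_diff(2)[OF i] by simp
qed

lemma bond_force_measurable:
  assumes "0 < \<epsilon>" and J: "(\<lambda>\<xi>. J \<bar>\<xi>\<bar>) \<in> borel_measurable lebesgue"
    and \<phi>: "continuous_on {0..} \<phi>" and u: "u \<in> borel_measurable borel"
  shows "(\<lambda>y. J (\<bar>y - x\<bar> / \<epsilon>) * (\<phi> (\<bar>y - x\<bar> * (strain u y x)\<^sup>2) * strain u y x))
    \<in> borel_measurable lebesgue"
proof -
  have "(\<lambda>y::real. (- x / \<epsilon>) + (1 / \<epsilon>) * y) \<in> lebesgue \<rightarrow>\<^sub>M lebesgue"
    using lebesgue_affine_measurable[of "\<lambda>_::real. 1 / \<epsilon>" "- x / \<epsilon>"] assms(1) by simp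
  from measurable_compose[OF this J]
  have 1: "(\<lambda>y. J (\<bar>y - x\<bar> / \<epsilon>)) \<in> borel_measurable lebesgue"
    using assms(1) by (simp add: diff_divide_distrib[symmetric] abs_divide)
  have [measurable]: "(\<lambda>y. strain u y x) \<in> borel_measurable borel"
    using u unfolding strain_def by measurable
  \<comment> \<open>Continuity of \<open>\<phi>\<close> is known on \<open>[0, \<infinity>)\<close> only, where its arguments lie.\<close>
  have "continuous_on UNIV (\<lambda>t. \<phi> (max 0 t))"
    by (rule continuous_on_compose2[OF \<phi>]) (auto intro!: continuous_intros)
  then have [measurable]: "(\<lambda>t. \<phi> (max 0 t)) \<in> borel_measurable borel"
    by (rule borel_measurable_continuous_onI)
  have "(\<lambda>y. \<phi> (max 0 (\<bar>y - x\<bar> * (strain u y x)\<^sup>2)) * strain u y x) \<in> borel_measurable borel"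
    by measurable
  then have "(\<lambda>y. \<phi> (\<bar>y - x\<bar> * (strain u y x)\<^sup>2) * strain u y x) \<in> borel_measurable borel"
    by (simp add: max_def)
  then have "(\<lambda>y. \<phi> (\<bar>y - x\<bar> * (strain u y x)\<^sup>2) * strain u y x) \<in> borel_measurable lebesgue"
    by (intro measurable_completion) simp
  with 1 show ?thesis by (rule borel_measurable_times)
qed

lemma pd_gradient_diff_bound:
  fixes \<phi> :: "real \<Rightarrow> real"
  assumes \<epsilon>: "0 < \<epsilon>" and J: "(\<lambda>\<xi>. J \<bar>\<xi>\<bar>) \<in> borel_measurable lebesgue" "\<And>\<xi>. \<bar>J \<bar>\<xi>\<bar>\<bar> \<le> M"
    and \<phi>0: "\<bar>\<phi> 0\<bar> \<le> \<beta>"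
    and lip: "\<And>s t. 0 \<le> s \<Longrightarrow> 0 \<le> t \<Longrightarrow> \<bar>\<phi> s - \<phi> t\<bar> \<le> \<kappa> * \<bar>s - t\<bar>" and \<kappa>: "0 \<le> \<kappa>"
    and u: "u \<in> borel_measurable borel" "\<And>y. \<bar>u y - u x\<bar> \<le> \<Lambda> * \<bar>y - x\<bar>" "\<And>y. \<bar>u y - u x\<bar> \<le> A"
    and v: "v \<in> borel_measurable borel" "\<And>y. \<bar>v y - v x\<bar> \<le> \<Lambda> * \<bar>y - x\<bar>" "\<And>y. \<bar>v y - v x\<bar> \<le> A"
    and uv: "\<And>y. \<bar>(v y - v x) - (u y - u x)\<bar> \<le> L * \<bar>y - x\<bar>"
  shows "\<bar>pd_gradient \<phi> J \<epsilon> v x - pd_gradient \<phi> J \<epsilon> u x\<bar>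
    \<le> 4 * M * (\<beta> + 3 * \<kappa> * A * \<Lambda>) * L / \<epsilon>"
proof -
  define g where "g = (\<lambda>u y. \<phi> (\<bar>y - x\<bar> * (strain u y x)\<^sup>2) * strain u y x)"
  define G where "G = (\<lambda>u y. J (\<bar>y - x\<bar> / \<epsilon>) * g u y)"
  have "\<kappa>-lipschitz_on {0..} \<phi>"
    using lip \<kappa> by (auto simp: lipschitz_on_def dist_real_def)
  then have cont: "continuous_on {0..} \<phi>" by (rule lipschitz_on_continuous_on)
  have pos: "0 \<le> M" "0 \<le> \<beta>" "0 \<le> A" "0 \<le> \<Lambda>" "0 \<le> L"
    using J(2)[of 0] \<phi>0 u(3)[of x] u(2)[of "x + 1"] uv[of "x + 1"]
    by (auto intro: order.trans[OF abs_ge_zero])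
  have Jb: "\<bar>J (\<bar>y - x\<bar> / \<epsilon>)\<bar> \<le> M" for y
    using J(2)[of "(y - x) / \<epsilon>"] \<epsilon> by (simp add: abs_divide)
  have b: "\<bar>g w y\<bar> \<le> (\<beta> + \<kappa> * A * \<Lambda>) * \<Lambda>"
    if "\<And>y. \<bar>w y - w x\<bar> \<le> \<Lambda> * \<bar>y - x\<bar>" "\<And>y. \<bar>w y - w x\<bar> \<le> A" for w y
  proof (cases "y = x")
    case True
    then show ?thesis using pos \<kappa> by (simp add: g_def strain_def)
  next
    case False
    then show ?thesis
      using bond_force_bounds(1)[of \<phi> \<beta> \<kappa> "\<bar>y - x\<bar>" "w y - w x" \<Lambda> A, OF \<phi>0 lip \<kappa> _ that]
      by (simp add: g_def strain_def)
  qed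
  have bd: "\<bar>g v y - g u y\<bar> \<le> (\<beta> + 3 * \<kappa> * A * \<Lambda>) * L" for y
  proof (cases "y = x")
    case True
    then show ?thesis using pos \<kappa> by (simp add: g_def strain_def)
  next
    case False
    then show ?thesis
      using bond_force_bounds(2)[of \<phi> \<beta> \<kappa> "\<bar>y - x\<bar>" "v y - v x" \<Lambda> A "u y - u x" L,
          OF \<phi>0 lip \<kappa> _ v(2,3) u(2,3) uv]
      by (simp add: g_def strain_def)
  qed
  have "\<bar>(LINT y:{x-\<epsilon>..x+\<epsilon>}|lebesgue. G v y) - (LINT y:{x-\<epsilon>..x+\<epsilon>}|lebesgue. G u y)\<bar>
      \<le> M * ((\<beta> + 3 * \<kappa> * A * \<Lambda>) * L) * ((x + \<epsilon>) - (x - \<epsilon>))"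
  proof (rule set_integral_diff_bound)
    show "G v \<in> borel_measurable lebesgue" "G u \<in> borel_measurable lebesgue"
      unfolding G_def g_def using bond_force_measurable[OF \<epsilon> J(1) cont] u(1) v(1) by blast+
    show "\<bar>G v y\<bar> \<le> M * ((\<beta> + \<kappa> * A * \<Lambda>) * \<Lambda>)" for y
      unfolding G_def abs_mult by (rule mult_mono) (use Jb b[OF v(2,3)] pos \<kappa> in auto)
    show "\<bar>G u y\<bar> \<le> M * ((\<beta> + \<kappa> * A * \<Lambda>) * \<Lambda>)" for y
      unfolding G_def abs_mult by (rule mult_mono) (use Jb b[OF u(2,3)] pos \<kappa> in auto)
    show "\<bar>G v y - G u y\<bar> \<le> M * ((\<beta> + 3 * \<kappa> * A * \<Lambda>) * L)" for y
      unfolding G_def right_diff_distrib[symmetric] abs_mult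
      by (rule mult_mono) (use Jb bd pos \<kappa> in auto)
  qed (use \<epsilon> in auto)
  then have I: "2 / \<epsilon>\<^sup>2 * \<bar>(LINT y:{x-\<epsilon>..x+\<epsilon>}|lebesgue. G v y) - (LINT y:{x-\<epsilon>..x+\<epsilon>}|lebesgue. G u y)\<bar>
      \<le> 2 / \<epsilon>\<^sup>2 * (M * ((\<beta> + 3 * \<kappa> * A * \<Lambda>) * L) * (2 * \<epsilon>))"
    by (intro mult_left_mono) auto
  have "pd_gradient \<phi> J \<epsilon> v x - pd_gradient \<phi> J \<epsilon> u x =
      - (2 / \<epsilon>\<^sup>2 * ((LINT y:{x-\<epsilon>..x+\<epsilon>}|lebesgue. G v y) - (LINT y:{x-\<epsilon>..x+\<epsilon>}|lebesgue. G u y)))"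
    by (simp add: pd_gradient_def G_def g_def right_diff_distrib)
  then have "\<bar>pd_gradient \<phi> J \<epsilon> v x - pd_gradient \<phi> J \<epsilon> u x\<bar> =
      2 / \<epsilon>\<^sup>2 * \<bar>(LINT y:{x-\<epsilon>..x+\<epsilon>}|lebesgue. G v y) - (LINT y:{x-\<epsilon>..x+\<epsilon>}|lebesgue. G u y)\<bar>"
    using \<epsilon> by (simp only: abs_minus_cancel abs_mult) simp
  also note I
  also have "2 / \<epsilon>\<^sup>2 * (M * ((\<beta> + 3 * \<kappa> * A * \<Lambda>) * L) * (2 * \<epsilon>))
      = 4 * M * (\<beta> + 3 * \<kappa> * A * \<Lambda>) * L / \<epsilon>"
    using \<epsilon> by (simp add: field_simps power2_eq_square)
  finally show ?thesis .
qed

section \<open>Regularity of the data\<close>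

text \<open>
  The bound on \<open>f''\<close> is given on the open half-line; the mean value theorem evaluates \<open>f''\<close> at
  interior points, so it still yields the Lipschitz bound up to \<open>0\<close>.
\<close>

lemma first_derivative_lipschitz:
  assumes f: "C_on 2 {0..} f" and \<kappa>: "\<And>x. 0 < x \<Longrightarrow> \<bar>nderiv {0..} 2 f x\<bar> \<le> \<kappa>"
    and st: "0 \<le> s" "0 \<le> t"
  shows "\<bar>nderiv {0..} 1 f s - nderiv {0..} 1 f t\<bar> \<le> \<kappa> * \<bar>s - t\<bar>"
  using st
proof (induction s t rule: linorder_wlog)
  case (le s t)
  show ?case
  proof (cases "s = t")
    case False
    then have "s < t" using le by simp
    have der: "(nderiv {0..} 1 f has_derivative (\<lambda>y. nderiv {0..} 2 f x * y)) (at x within {s..t})"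
      if "s \<le> x" "x \<le> t" for x
      using DERIV_subset[OF nderiv_has_derivative[OF f, of 1 x], of "{s..t}"] that le
      by (auto simp: has_field_derivative_def numeral_2_eq_2)
    from mvt_simple[OF \<open>s < t\<close> der] obtain x where x: "x \<in> {s<..<t}"
      "nderiv {0..} 1 f t - nderiv {0..} 1 f s = nderiv {0..} 2 f x * (t - s)" by blast
    then have "\<bar>nderiv {0..} 1 f t - nderiv {0..} 1 f s\<bar> \<le> \<kappa> * (t - s)"
      using \<kappa>[of x] le by (simp add: abs_mult mult_right_mono)
    then show ?thesis using le by (simp add: abs_minus_commute)
  qed simp
next
  case (sym s t)
  then show ?case by (simp add: abs_minus_commute)
qed

text \<open>
  Being zero off the open interval, \<open>u\<close> factors through the projection onto \<open>[a, b]\<close>; so it is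
  continuous on the line, and its Lipschitz bound on \<open>[a, b]\<close> controls increments to any \<open>y\<close>.
\<close>

lemma zero_extension_regularity:
  fixes u :: "real \<Rightarrow> real"
  assumes ab: "a < b" and u: "C_on n {a..b} u" "0 < n"
    and u0: "\<And>x. x \<notin> {a<..<b} \<Longrightarrow> u x = 0"
  obtains \<Lambda> where "0 \<le> \<Lambda>" "u \<in> borel_measurable borel"
    "\<And>x y. x \<in> {a..b} \<Longrightarrow> \<bar>u y - u x\<bar> \<le> \<Lambda> * \<bar>y - x\<bar> \<and> \<bar>u y - u x\<bar> \<le> \<Lambda> * (b - a)"
proof -
  have "continuous_on {a..b} (nderiv {a..b} 1 u)" using u by (auto simp: C_on_def)
  then have "bounded (nderiv {a..b} 1 u ` {a..b})"
    by (intro compact_imp_bounded compact_continuous_image) auto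
  then obtain \<Lambda> where \<Lambda>: "0 < \<Lambda>" "\<And>x. x \<in> {a..b} \<Longrightarrow> \<bar>nderiv {a..b} 1 u x\<bar> \<le> \<Lambda>"
    by (auto simp: bounded_pos)
  have lip: "\<bar>u y - u x\<bar> \<le> \<Lambda> * \<bar>y - x\<bar>" if "x \<in> {a..b}" "y \<in> {a..b}" for x y
    by (rule lipschitz_of_derivative_bound[where g' = "nderiv {a..b} 1 u" and c = a and d = b])
       (use nderiv_has_derivative[OF u(1), of 0] u(2) \<Lambda> that in \<open>auto simp: nderiv_def\<close>)
  define pr where "pr = (\<lambda>y. max a (min b y))"
  have pr: "pr y \<in> {a..b}" "u (pr y) = u y" for y
    using ab u0[of y] u0[of a] u0[of b] by (auto simp: pr_def max_def min_def)
  have "\<bar>u y - u x\<bar> \<le> \<Lambda> * \<bar>y - x\<bar> \<and> \<bar>u y - u x\<bar> \<le> \<Lambda> * (b - a)" if x: "x \<in> {a..b}" for x y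
  proof -
    have "\<bar>pr y - x\<bar> \<le> \<bar>y - x\<bar>" "\<bar>pr y - x\<bar> \<le> b - a"
      using x by (auto simp: pr_def max_def min_def)
    then show ?thesis
      using lip[OF x pr(1)[of y]] pr(2)[of y] \<Lambda>(1)
        mult_left_mono[of "\<bar>pr y - x\<bar>" "\<bar>y - x\<bar>" \<Lambda>] mult_left_mono[of "\<bar>pr y - x\<bar>" "b - a" \<Lambda>]
      by linarith
  qed
  moreover have "u \<in> borel_measurable borel"
  proof -
    have "continuous_on {a..b} u" using u by (auto simp: C_on_def nderiv_def)
    then have "continuous_on UNIV (\<lambda>y. u (pr y))"
      by (rule continuous_on_compose2) (use pr in \<open>auto simp: pr_def intro!: continuous_intros\<close>)
    then show ?thesis using pr by (intro borel_measurable_continuous_onI) simp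
  qed
  ultimately show ?thesis using that \<Lambda>(1) by (meson less_imp_le)
qed

section \<open>The consistency error\<close>

text \<open>
  The constant may depend on the strains and increments of \<open>I\<^sub>h u\<close> only through bounds uniform in the
  mesh.  These exist because \<open>[a, b]\<close> consists of elements, so that \<open>h \<le> b - a\<close>: the strains are
  at most those of \<open>u\<close> plus \<open>B (b - a)\<^sup>p\<close>, which is \<open>\<Lambda>\<close> below, and the increments at most
  \<open>\<Lambda> (b - a)\<close>.
\<close>

lemma pd_gradient_interpolation_error:
  fixes a b M \<kappa> :: real and u \<phi> J :: "real \<Rightarrow> real"
  assumes ab: "a < b" and p: "p \<ge> 1"
    and J: "(\<lambda>\<xi>. J \<bar>\<xi>\<bar>) \<in> borel_measurable lebesgue" "\<And>\<xi>. \<bar>J \<bar>\<xi>\<bar>\<bar> \<le> M"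
    and lip: "\<And>s t. 0 \<le> s \<Longrightarrow> 0 \<le> t \<Longrightarrow> \<bar>\<phi> s - \<phi> t\<bar> \<le> \<kappa> * \<bar>s - t\<bar>" and \<kappa>: "0 \<le> \<kappa>"
    and u: "C_on (p + 1) {a..b} u" "bounded (nderiv {a..b} (p + 1) u ` {a..b})"
    and u0: "\<And>x. x \<notin> {a<..<b} \<Longrightarrow> u x = 0"
  shows "\<exists>C. \<forall>\<epsilon> h. admissible_mesh a b \<epsilon> h \<longrightarrow>
        (SUP i\<in>grid_indices h p {a..b}.
           \<bar>pd_gradient \<phi> J \<epsilon> (interpolant h p u) (grid_point h p i)
             - pd_gradient \<phi> J \<epsilon> u (grid_point h p i)\<bar>) \<le> C * (h ^ p / \<epsilon>)"
proof -
  obtain \<Lambda>0 where \<Lambda>0: "0 \<le> \<Lambda>0" and um: "u \<in> borel_measurable borel"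
    and uL: "\<And>x y. x \<in> {a..b} \<Longrightarrow> \<bar>u y - u x\<bar> \<le> \<Lambda>0 * \<bar>y - x\<bar> \<and> \<bar>u y - u x\<bar> \<le> \<Lambda>0 * (b - a)"
    using zero_extension_regularity[OF ab u(1) _ u0] by auto
  obtain B where B: "0 < B" "\<And>x. x \<in> {a..b} \<Longrightarrow> \<bar>nderiv {a..b} (p + 1) u x\<bar> \<le> B"
    using u(2) by (auto simp: bounded_pos)
  define \<Lambda> where "\<Lambda> = \<Lambda>0 + B * (b - a) ^ p"
  define A where "A = \<Lambda> * (b - a)"
  define C where "C = 4 * M * (\<bar>\<phi> 0\<bar> + 3 * \<kappa> * A * \<Lambda>) * B"
  have "(SUP i\<in>grid_indices h p {a..b}.
           \<bar>pd_gradient \<phi> J \<epsilon> (interpolant h p u) (grid_point h p i)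
             - pd_gradient \<phi> J \<epsilon> u (grid_point h p i)\<bar>) \<le> C * (h ^ p / \<epsilon>)"
    if mesh: "admissible_mesh a b \<epsilon> h" for \<epsilon> h
  proof -
    have h: "0 < h" and \<epsilon>: "0 < \<epsilon>" and U: "union_of_elements h {a..b}"
      using mesh by (auto simp: admissible_mesh_def)
    obtain k l where kl: "a = of_int k * h" "b = of_int l * h" "k < l"
      using interval_union_of_elements[OF h ab U] by blast
    have "1 * h \<le> (of_int (l - k)) * h"
      using kl(3) h by (intro mult_right_mono) linarith+
    then have hab: "h \<le> b - a" using kl by (simp add: algebra_simps)
    define L where "L = B * h ^ p"
    have L: "0 \<le> L" "L \<le> B * (b - a) ^ p"
      using B(1) h hab by (auto simp: L_def intro!: mult_left_mono power_mono)
    have \<Lambda>: "\<Lambda>0 + L \<le> \<Lambda>" using L by (simp add: \<Lambda>_def)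
    show ?thesis
    proof (rule cSUP_least)
      have "grid_point h p (k * int p) = a" using p kl by (simp add: grid_point_def)
      then show "grid_indices h p {a..b} \<noteq> {}"
        using ab by (auto simp: grid_indices_def intro!: exI[of _ "k * int p"])
    next
      fix i assume "i \<in> grid_indices h p {a..b}"
      define x where "x = grid_point h p i"
      define v where "v = interpolant h p u"
      have x: "x \<in> {a..b}" using \<open>i \<in> _\<close> by (simp add: grid_indices_def x_def)
      have vx: "v x = u x" by (simp add: v_def x_def interpolant_grid_point[OF h p])
      have err: "\<bar>v y - u y\<bar> \<le> L * \<bar>y - x\<bar>" "y \<notin> {a..b} \<Longrightarrow> v y = 0" for y
        unfolding v_def x_def L_def
        using interpolation_error_from_grid_point[OF h p kl(1,2) u(1) B(2) _ u0] B(1)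
        by (simp_all add: less_imp_le)
      have err_total: "\<bar>v y - u y\<bar> \<le> L * (b - a)" for y
      proof (cases "y \<in> {a..b}")
        case True
        then have "\<bar>y - x\<bar> \<le> b - a" using x by auto
        then show ?thesis using err(1)[of y] mult_left_mono[OF _ L(1)] order.trans by blast
      next
        case False
        then show ?thesis using err(2)[of y] u0[of y] L(1) ab by auto
      qed
      have grow: "\<Lambda>0 * t + L * t \<le> \<Lambda> * t" "\<Lambda>0 * t \<le> \<Lambda> * t" if "0 \<le> t" for t
        using mult_right_mono[OF \<Lambda> that] mult_nonneg_nonneg[OF L(1) that] by (auto simp: algebra_simps)
      have "\<bar>pd_gradient \<phi> J \<epsilon> v x - pd_gradient \<phi> J \<epsilon> u x\<bar>
          \<le> 4 * M * (\<bar>\<phi> 0\<bar> + 3 * \<kappa> * A * \<Lambda>) * L / \<epsilon>"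
      proof (rule pd_gradient_diff_bound[OF \<epsilon> J order.refl lip \<kappa> um])
        show "v \<in> borel_measurable borel" by (simp add: v_def interpolant_measurable)
        fix y
        show "\<bar>u y - u x\<bar> \<le> \<Lambda> * \<bar>y - x\<bar>" "\<bar>u y - u x\<bar> \<le> A"
          using uL[OF x, of y] grow[of "\<bar>y - x\<bar>"] grow[of "b - a"] ab
          unfolding A_def by linarith+
        show "\<bar>v y - v x\<bar> \<le> \<Lambda> * \<bar>y - x\<bar>"
          using uL[OF x, of y] err(1)[of y] vx grow[of "\<bar>y - x\<bar>"] by linarith
        show "\<bar>v y - v x\<bar> \<le> A"
          using uL[OF x, of y] err_total[of y] vx grow[of "b - a"] ab unfolding A_def by linarith
        show "\<bar>(v y - v x) - (u y - u x)\<bar> \<le> L * \<bar>y - x\<bar>"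
          using err(1)[of y] vx by simp
      qed
      also have "\<dots> = C * (h ^ p / \<epsilon>)" by (simp add: C_def L_def)
      finally show "\<bar>pd_gradient \<phi> J \<epsilon> (interpolant h p u) (grid_point h p i)
             - pd_gradient \<phi> J \<epsilon> u (grid_point h p i)\<bar> \<le> C * (h ^ p / \<epsilon>)"
        by (simp add: v_def x_def)
    qed
  qed
  then show ?thesis by blast
qed

theorem proposition4:
  fixes a b M :: real and p :: nat and f J u :: "real \<Rightarrow> real"
  assumes "a < b"
    and "p \<ge> 1"
    and f_smooth: "smooth_on {0..} f"
    and f_concave: "concave_on {0..} f"
    and f_pos: "\<forall>r>0. f r > 0"
    and f_zero: "((\<lambda>r. f r / r) \<longlongrightarrow> nderiv {0..} 1 f 0) (at_right 0)"
    and f_infinity: "\<exists>f_inf. (f \<longlongrightarrow> f_inf) at_top"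
    and f_bounded: "\<forall>n\<in>{2, 3, 4}. bounded (nderiv {0..} n f ` {0<..})"
    and J_measurable: "(\<lambda>\<xi>. J \<bar>\<xi>\<bar>) \<in> borel_measurable lebesgue"
    and J_support: "\<forall>\<xi>. \<xi> \<notin> {-1..1} \<longrightarrow> J \<bar>\<xi>\<bar> = 0"
    and J_bounds: "\<forall>\<xi>\<in>{-1..1}. 0 \<le> J \<bar>\<xi>\<bar> \<and> J \<bar>\<xi>\<bar> \<le> M"
    and u_diff: "C_on (p + 1) {a..b} u"
    and u_bounded: "bounded (nderiv {a..b} (p + 1) u ` {a..b})"
    and u_zero: "\<forall>x. x \<notin> {a<..<b} \<longrightarrow> u x = 0"
  shows
    "(\<exists>C. \<forall>\<epsilon> h. admissible_mesh a b \<epsilon> h \<longrightarrow>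
        (SUP i\<in>grid_indices h p {a..b}.
           \<bar>grad_PD_lin f J \<epsilon> (interpolant h p u) (grid_point h p i)
             - grad_PD_lin f J \<epsilon> u (grid_point h p i)\<bar>) \<le> C * (h ^ p / \<epsilon>)) \<and>
     (\<exists>C. \<forall>\<epsilon> h. admissible_mesh a b \<epsilon> h \<longrightarrow>
        (SUP i\<in>grid_indices h p {a..b}.
           \<bar>grad_PD f J \<epsilon> (interpolant h p u) (grid_point h p i)
             - grad_PD f J \<epsilon> u (grid_point h p i)\<bar>) \<le> C * (h ^ p / \<epsilon>))"
proof -
  have J: "\<bar>J \<bar>\<xi>\<bar>\<bar> \<le> M" for \<xi>
  proof (cases "\<xi> \<in> {-1..1}")
    case False
    \<comment> \<open>Outside the support the bound is \<open>M \<ge> J 0 \<ge> 0\<close>.\<close>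
    moreover have "0 \<le> M" using J_bounds[rule_format, of 0] by simp
    ultimately show ?thesis using J_support by simp
  qed (use J_bounds in auto)
  obtain \<kappa> where \<kappa>: "0 < \<kappa>" "\<And>x. 0 < x \<Longrightarrow> \<bar>nderiv {0..} 2 f x\<bar> \<le> \<kappa>"
    using f_bounded by (auto simp: bounded_pos)
  have f2: "C_on 2 {0..} f" using f_smooth by (simp add: smooth_on_def)
  have u0: "\<And>x. x \<notin> {a<..<b} \<Longrightarrow> u x = 0" using u_zero by blast
  show ?thesis
    unfolding grad_PD_eq grad_PD_lin_eq
  proof (intro conjI)
    show "\<exists>C. \<forall>\<epsilon> h. admissible_mesh a b \<epsilon> h \<longrightarrow>
        (SUP i\<in>grid_indices h p {a..b}.
           \<bar>pd_gradient (\<lambda>_. nderiv {0..} 1 f 0) J \<epsilon> (interpolant h p u) (grid_point h p i)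
             - pd_gradient (\<lambda>_. nderiv {0..} 1 f 0) J \<epsilon> u (grid_point h p i)\<bar>) \<le> C * (h ^ p / \<epsilon>)"
      by (rule pd_gradient_interpolation_error[where \<kappa> = 0, OF assms(1,2) J_measurable J _ _
            u_diff u_bounded u0]) auto
    show "\<exists>C. \<forall>\<epsilon> h. admissible_mesh a b \<epsilon> h \<longrightarrow>
        (SUP i\<in>grid_indices h p {a..b}.
           \<bar>pd_gradient (nderiv {0..} 1 f) J \<epsilon> (interpolant h p u) (grid_point h p i)
             - pd_gradient (nderiv {0..} 1 f) J \<epsilon> u (grid_point h p i)\<bar>) \<le> C * (h ^ p / \<epsilon>)"
      by (rule pd_gradient_interpolation_error[where \<kappa> = \<kappa>, OF assms(1,2) J_measurable J _ _
            u_diff u_bounded u0]) (use first_derivative_lipschitz[OF f2 \<kappa>(2)] \<kappa>(1) in auto)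
  qed
qed

end
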